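(* Let $f_1, f_2 \colon \mathbb{R}^n \to \mathbb{R}\cup\{+\infty\}$ be lower semi-continuous functions such that $\mathrm{dom} f_1$, $\mathrm{dom} f_2$ and $\mathrm{dom}(f_1+f_2)$ are unbounded, and such that $D^{\uparrow}_{f_1}(\infty) \cap \mathrm{int}\, D^{\uparrow}_{f_2}(\infty) \ne \emptyset$. Then $$(f_1 + f_2)^{\uparrow}(\infty; v) \le f_1^{\uparrow}(\infty; v) + f_2^{\uparrow}(\infty; v) \quad \text{for all } v \in \mathbb{R}^n,$$ $$\partial (f_1 + f_2)(\infty) \subset \partial f_1(\infty) +\partial f_2(\infty).$$
   Context: $\mathbb{R}^n$ carries the Euclidean norm and inner product; $\mathbb{B}_\epsilon(v)$ is the closed ball of radius $\epsilon$ centered at $v$; $t_k \searrow 0$ means $t_k>0$ and $t_k$ decreases to $0$. Convention: $\lambda_1+\lambda_2=+\infty$ if either of $\lambda_1,\lambda_2$ is $+\infty$ (even if the other is $-\infty$). The sum of two sets is the Minkowski sum (empty if one summand is empty). For $f \colon \mathbb{R}^n \to \mathbb{R}\cup\{+\infty\}$ with unbounded effective domain $\mathrm{dom} f := \{x \mid f(x) < \infty\}$, let $\mathrm{epi} f := \{(x,y) \in \mathbb{R}^n\times\mathbb{R} \mid f(x)\le y\}$ and $I=\{1,\ldots,n\}\subset\{1,\ldots,n+1\}$. $T_{\mathrm{epi} f}(\infty_I)$ is the set of all $(v,r) \in \mathbb{R}^n\times\mathbb{R}$ such that for all sequences $(x_k,y_k)\in \mathrm{epi} f$ with $\|x_k\|\to\infty$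 and $t_k\searrow 0$ there exists $(v_k,r_k)\to(v,r)$ with $(x_k,y_k)+t_k(v_k,r_k)\in\mathrm{epi} f$ for all $k$; $N_{\mathrm{epi} f}(\infty_I) := \{w \in \mathbb{R}^{n}\times\mathbb{R} \mid \langle z, w\rangle\le 0 \text{ for all } z \in T_{\mathrm{epi} f}(\infty_I)\}$; and $\partial f(\infty) := \{\xi\in\mathbb{R}^n \mid (\xi,-1)\in N_{\mathrm{epi} f}(\infty_I)\}$. $$f^{\uparrow}(\infty; v) := \lim_{\epsilon \searrow 0}\ \limsup_{\|x\|\to\infty,\ x \in \mathrm{dom} f,\ t \searrow 0}\ \inf_{w \in \mathbb{B}_\epsilon(v)} \frac{f(x + t w) - f(x)}{t} \in [-\infty,+\infty],$$ and $D^{\uparrow}_{f}(\infty) := \{ v \in \mathbb{R}^n \mid f^{\uparrow}(\infty; v) < +\infty\}$. *)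

theory Defs
  imports "HOL-Analysis.Analysis"
begin

text \<open>
  Functions with values in the reals extended by \<open>+\<infinity>\<close> are functions into \<^typ>\<open>ereal\<close> that never
  take the value \<open>-\<infinity>\<close>. Addition on \<^typ>\<open>ereal\<close> satisfies \<open>\<infinity> + a = a + \<infinity> = \<infinity>\<close> for every \<open>a\<close>,
  including \<open>a = -\<infinity>\<close>.
\<close>

definition effective_dom :: "('a \<Rightarrow> ereal) \<Rightarrow> 'a set" where
  "effective_dom f = {x. f x < \<infinity>}"

definition epi :: "('a \<Rightarrow> ereal) \<Rightarrow> ('a \<times> real) set" where
  "epi f = {(x, y). f x \<le> ereal y}"

definition lower_semicontinuous :: "('a::topological_space \<Rightarrow> ereal) \<Rightarrow> bool" where
  "lower_semicontinuous f \<longleftrightarrow> (\<forall>x. f x \<le> Liminf (at x) f)"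

text \<open>
  Tangent and normal cones at infinity of a subset of \<open>'a \<times> real\<close> with respect to the block of
  coordinates of the first factor: only the first component is required to tend to infinity.
\<close>

definition tangent_cone_infinity :: "('a::euclidean_space \<times> real) set \<Rightarrow> ('a \<times> real) set" where
  "tangent_cone_infinity C = {z.
     \<forall>(p :: nat \<Rightarrow> 'a \<times> real) (t :: nat \<Rightarrow> real).
       (\<forall>k. p k \<in> C) \<and> filterlim (\<lambda>k. norm (fst (p k))) at_top sequentially \<and>
       (\<forall>k. 0 < t k) \<and> decseq t \<and> t \<longlonglongrightarrow> 0 \<longrightarrow>
       (\<exists>w :: nat \<Rightarrow> 'a \<times> real. w \<longlonglongrightarrow> z \<and> (\<forall>k. p k + t k *\<^sub>R w k \<in> C))}"

definition normal_cone_infinity :: "('a::euclidean_space \<times> real) set \<Rightarrow> ('a \<times> real) set" where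
  "normal_cone_infinity C = {w. \<forall>z \<in> tangent_cone_infinity C. inner z w \<le> 0}"

definition subdifferential_infinity :: "('a::euclidean_space \<Rightarrow> ereal) \<Rightarrow> 'a set" where
  "subdifferential_infinity f = {\<xi>. (\<xi>, - 1) \<in> normal_cone_infinity (epi f)}"

text \<open>
  On the filter below, eventually \<open>f x\<close> is finite (for \<open>f\<close> avoiding \<open>-\<infinity>\<close>) and \<open>t > 0\<close>, so the
  difference quotient involves no undefined arithmetic. The inner expression increases as
  \<open>\<epsilon>\<close> decreases, so the outer limit exists in \<^typ>\<open>ereal\<close>.
\<close>

definition upper_subderivative_infinity ::
    "('a::euclidean_space \<Rightarrow> ereal) \<Rightarrow> 'a \<Rightarrow> ereal" where
  "upper_subderivative_infinity f v =
     Lim (at_right (0::real)) (\<lambda>\<epsilon>.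
       Limsup (inf at_infinity (principal (effective_dom f)) \<times>\<^sub>F at_right (0::real)) (\<lambda>(x, t).
         INF w \<in> cball v \<epsilon>. (f (x + t *\<^sub>R w) - f x) / ereal t))"

definition upper_subderivative_dom :: "('a::euclidean_space \<Rightarrow> ereal) \<Rightarrow> 'a set" where
  "upper_subderivative_dom f = {v. upper_subderivative_infinity f v < \<infinity>}"

end

theory Submission
  imports Defs
begin

text \<open>
  At a direction \<open>v0\<close> interior to the domain of the second subderivative, lower semicontinuity makes
  the descent estimate for \<open>f2\<close> hold for all directions near \<open>v0\<close>, not just for some. For the
  inequality one first moves by \<open>(1 - m) t\<close> along nearly \<open>v\<close>, with possibly different directions
  for \<open>f1\<close> and \<open>f2\<close>, and then by \<open>m t\<close> along nearly \<open>v0\<close>; the freedom in the second move for \<open>f2\<close>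
  absorbs the mismatch, so both functions are estimated at a common endpoint, and \<open>m\<close> tends to 0.
  The inclusion follows by separating the tangent cone of \<open>epi f1\<close> from the cone of all \<open>(v, b)\<close>
  with \<open>b < inner v xi - r\<close> for some tangent \<open>(v, r)\<close> of \<open>epi f2\<close>; the separating hyperplane is
  not vertical because of \<open>v0\<close>.
\<close>

section \<open>The subderivative at infinity in terms of real descent rates\<close>

lemma Lim_at_right_antimono:
  fixes g :: "real \<Rightarrow> ereal"
  assumes "\<And>a b. 0 < a \<Longrightarrow> a \<le> b \<Longrightarrow> g b \<le> g a"
  shows "Lim (at_right 0) g = (SUP e\<in>{0<..}. g e)"
proof (rule tendsto_Lim)
  show "(g \<longlongrightarrow> (SUP e\<in>{0<..}. g e)) (at_right 0)"
  proof (rule order_tendstoI)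
    fix a assume "a < (SUP e\<in>{0<..}. g e)"
    then obtain d where d: "d > 0" "a < g d"
      by (auto simp: less_SUP_iff)
    have "eventually (\<lambda>e. e \<in> {0<..<d}) (at_right 0)"
      using d(1) by (rule eventually_at_right_real)
    then show "eventually (\<lambda>e. a < g e) (at_right 0)"
    proof eventually_elim
      case (elim e)
      then show ?case using d(2) assms[of e d] by (auto intro: less_le_trans)
    qed
  next
    fix a assume *: "(SUP e\<in>{0<..}. g e) < a"
    have "eventually (\<lambda>e::real. e \<in> {0<..}) (at_right 0)"
      by (simp add: eventually_at_right_less)
    then show "eventually (\<lambda>e. g e < a) (at_right 0)"
      by eventually_elim (meson "*" SUP_upper le_less_trans)
  qed
qed simp

definition infinity_filter :: "('a::euclidean_space \<Rightarrow> ereal) \<Rightarrow> ('a \<times> real) filter" where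
  "infinity_filter f = inf at_infinity (principal (effective_dom f)) \<times>\<^sub>F at_right 0"

lemma eventually_infinity_filter:
  "eventually P (infinity_filter f) \<longleftrightarrow>
    (\<exists>M s. 0 < s \<and> (\<forall>x t. f x < \<infinity> \<and> M \<le> norm x \<and> 0 < t \<and> t < s \<longrightarrow> P (x, t)))"
proof
  assume "eventually P (infinity_filter f)"
  then obtain Pf Pg where
    1: "eventually Pf (inf at_infinity (principal (effective_dom f)))"
    "eventually Pg (at_right (0::real))" "\<And>x t. Pf x \<Longrightarrow> Pg t \<Longrightarrow> P (x, t)"
    unfolding infinity_filter_def eventually_prod_filter by blast
  from 1(1) obtain M where M: "\<And>x. M \<le> norm x \<Longrightarrow> f x < \<infinity> \<Longrightarrow> Pf x"
    by (auto simp: eventually_inf_principal eventually_at_infinity effective_dom_def)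
  from 1(2) obtain s where "s > 0" "\<And>t. 0 < t \<Longrightarrow> t < s \<Longrightarrow> Pg t"
    by (auto simp: eventually_at_right_field)
  with M 1(3)
  show "\<exists>M s. 0 < s \<and> (\<forall>x t. f x < \<infinity> \<and> M \<le> norm x \<and> 0 < t \<and> t < s \<longrightarrow> P (x, t))"
    by blast
next
  assume "\<exists>M s. 0 < s \<and> (\<forall>x t. f x < \<infinity> \<and> M \<le> norm x \<and> 0 < t \<and> t < s \<longrightarrow> P (x, t))"
  then obtain M s where *: "0 < s"
    "\<And>x t. f x < \<infinity> \<Longrightarrow> M \<le> norm x \<Longrightarrow> 0 < t \<Longrightarrow> t < s \<Longrightarrow> P (x, t)"
    by blast
  have "eventually (\<lambda>x. f x < \<infinity> \<and> M \<le> norm x) (inf at_infinity (principal (effective_dom f)))"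
    by (auto simp: eventually_inf_principal eventually_at_infinity effective_dom_def)
  moreover have "eventually (\<lambda>t. 0 < t \<and> t < s) (at_right (0::real))"
    using *(1) by (auto simp: eventually_at_right_field)
  ultimately show "eventually P (infinity_filter f)"
    unfolding infinity_filter_def eventually_prod_filter using *(2) by blast
qed

text \<open>A real stand-in for the bound
  \<open>upper_subderivative_infinity f v \<le> ereal r\<close>. Multiplying out the quotient
  removes the \<open>ereal\<close> subtraction and division, and naming a witness \<open>w\<close>
  replaces the infimum.\<close>

definition descent_rate :: "('a::euclidean_space \<Rightarrow> ereal) \<Rightarrow> 'a \<Rightarrow> real \<Rightarrow> bool" where
  "descent_rate f v r \<longleftrightarrow> (\<forall>e>0. \<forall>\<^sub>F (x, t) in infinity_filter f.
     \<exists>w\<in>cball v e. f (x + t *\<^sub>R w) \<le> f x + ereal (t * r))"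

lemma descent_rateE:
  assumes "descent_rate f v r" "0 < e"
  obtains M s where "0 < s"
    "\<And>x t. f x < \<infinity> \<Longrightarrow> M \<le> norm x \<Longrightarrow> 0 < t \<Longrightarrow> t < s \<Longrightarrow>
       \<exists>w\<in>cball v e. f (x + t *\<^sub>R w) \<le> f x + ereal (t * r)"
proof -
  have "\<forall>\<^sub>F (x, t) in infinity_filter f. \<exists>w\<in>cball v e. f (x + t *\<^sub>R w) \<le> f x + ereal (t * r)"
    using assms by (simp add: descent_rate_def)
  then show thesis
    using that unfolding eventually_infinity_filter prod.case by metis
qed

text \<open>Shrinking the ball raises the infimum, so the outer limit is a supremum.\<close>

lemma upper_subderivative_infinity_eq_SUP:
  "upper_subderivative_infinity f v =
     (SUP e\<in>{0<..}. Limsup (infinity_filter f) (\<lambda>(x, t).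
         INF w\<in>cball v e. (f (x + t *\<^sub>R w) - f x) / ereal t))"
  unfolding upper_subderivative_infinity_def infinity_filter_def
proof (rule Lim_at_right_antimono, rule Limsup_mono, rule always_eventually, clarify)
  fix a b :: real and x t
  assume "0 < a" "a \<le> b"
  then show "(INF w\<in>cball v b. (f (x + t *\<^sub>R w) - f x) / ereal t)
      \<le> (INF w\<in>cball v a. (f (x + t *\<^sub>R w) - f x) / ereal t)"
    by (intro INF_superset_mono) auto
qed

lemma ereal_quotient_le_iff:
  fixes a b :: ereal
  assumes "a \<noteq> -\<infinity>" "a < \<infinity>" "0 < t"
  shows "(b - a) / ereal t \<le> ereal r \<longleftrightarrow> b \<le> a + ereal (t * r)"
  using assms by (cases a; cases b) (auto simp: divide_simps algebra_simps)

text \<open>Strictness produces the witness: an infimum strictly below \<open>r\<close> is beaten by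
  an actual \<open>w\<close>, while an infimum equal to \<open>r\<close> need not be
  attained.\<close>

lemma descent_rate_if_upper_subderivative_less:
  assumes f: "\<And>x. f x \<noteq> -\<infinity>" and less: "upper_subderivative_infinity f v < ereal r"
  shows "descent_rate f v r"
  unfolding descent_rate_def
proof (intro allI impI)
  fix e :: real assume "e > 0"
  let ?g = "\<lambda>(x, t). INF w\<in>cball v e. (f (x + t *\<^sub>R w) - f x) / ereal t"
  have "Limsup (infinity_filter f) ?g \<le> upper_subderivative_infinity f v"
    unfolding upper_subderivative_infinity_eq_SUP by (rule SUP_upper) (use \<open>e > 0\<close> in simp)
  then have "Limsup (infinity_filter f) ?g < ereal r"
    using less by (rule le_less_trans)
  then have "\<forall>\<^sub>F p in infinity_filter f. ?g p < ereal r"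
    by (rule Limsup_lessD)
  moreover have "\<forall>\<^sub>F (x, t) in infinity_filter f. f x < \<infinity> \<and> 0 < t"
    unfolding eventually_infinity_filter by (intro exI[of _ 1]) auto
  ultimately show "\<forall>\<^sub>F (x, t) in infinity_filter f.
      \<exists>w\<in>cball v e. f (x + t *\<^sub>R w) \<le> f x + ereal (t * r)"
  proof eventually_elim
    case (elim p)
    obtain x t where p: "p = (x, t)" by (cases p)
    from elim p obtain w where "w \<in> cball v e" "(f (x + t *\<^sub>R w) - f x) / ereal t < ereal r"
      by (auto simp: INF_less_iff)
    with elim p f show ?case
      using ereal_quotient_le_iff[of "f x" t "f (x + t *\<^sub>R w)" r] by auto
  qed
qed

lemma descent_rate_exists:
  assumes "\<And>x. f x \<noteq> -\<infinity>" "v \<in> upper_subderivative_dom f"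
  obtains r where "descent_rate f v r"
proof -
  from assms(2) obtain r where "upper_subderivative_infinity f v < ereal r"
    unfolding upper_subderivative_dom_def using ereal_dense2 by blast
  with assms(1) that show thesis
    using descent_rate_if_upper_subderivative_less by blast
qed

lemma upper_subderivative_le_if_descent_rate:
  assumes f: "\<And>x. f x \<noteq> -\<infinity>" and "descent_rate f v r"
  shows "upper_subderivative_infinity f v \<le> ereal r"
  unfolding upper_subderivative_infinity_eq_SUP
proof (rule SUP_least, rule Limsup_bounded)
  fix e :: real assume "e \<in> {0<..}"
  then have "\<forall>\<^sub>F (x, t) in infinity_filter f. \<exists>w\<in>cball v e. f (x + t *\<^sub>R w) \<le> f x + ereal (t * r)"
    using assms(2) by (auto simp: descent_rate_def)
  moreover have "\<forall>\<^sub>F (x, t) in infinity_filter f. f x < \<infinity> \<and> 0 < t"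
    unfolding eventually_infinity_filter by (intro exI[of _ 1]) auto
  ultimately show "\<forall>\<^sub>F p in infinity_filter f.
      (case p of (x, t) \<Rightarrow> INF w\<in>cball v e. (f (x + t *\<^sub>R w) - f x) / ereal t) \<le> ereal r"
  proof eventually_elim
    case (elim p)
    obtain x t where p: "p = (x, t)" by (cases p)
    from elim p obtain w where w: "w \<in> cball v e" "f (x + t *\<^sub>R w) \<le> f x + ereal (t * r)"
      by auto
    with elim p f have "(f (x + t *\<^sub>R w) - f x) / ereal t \<le> ereal r"
      using ereal_quotient_le_iff[of "f x" t "f (x + t *\<^sub>R w)" r] by auto
    with w p show ?case
      by (auto intro: INF_lower2)
  qed
qed

section \<open>Uniform descent near interior directions\<close>

lemma lower_semicontinuous_sequentially:
  assumes "lower_semicontinuous f" "x \<longlonglongrightarrow> z" "\<And>k. f (x k) \<le> c"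
  shows "f z \<le> c"
proof (rule ccontr)
  assume "\<not> f z \<le> c"
  then have c: "c < f z" by simp
  with assms(1) have "c < Liminf (at z) f"
    unfolding lower_semicontinuous_def by (metis less_le_trans)
  then have "\<forall>\<^sub>F y in at z. c < f y"
    by (rule less_LiminfD)
  \<comment> \<open>The liminf along \<open>at z\<close> says nothing about the point
    \<open>z\<close> itself; there the inequality is \<open>c\<close>.\<close>
  with c have "\<forall>\<^sub>F y in nhds z. c < f y"
    by (auto simp: eventually_at_filter elim: eventually_mono)
  with assms(2) have "\<forall>\<^sub>F k in sequentially. c < f (x k)"
    unfolding filterlim_iff by blast
  with assms(3) show False
    by (metis eventually_happens' leD sequentially_bot)
qed

text \<open>
  The target \<open>x + t *\<^sub>R y\<close> is reached by steps of length \<open>t / 2, t / 4, \<dots>\<close>, each of which aims at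
  twice the remaining direction minus \<open>v\<close>; this makes the next remaining direction deviate from
  \<open>v\<close> by the error of one step only, so that errors do not accumulate.
\<close>

lemma uniform_descent_on_interior:
  fixes f :: "'a::euclidean_space \<Rightarrow> ereal"
  assumes f: "\<And>x. f x \<noteq> -\<infinity>" and lsc: "lower_semicontinuous f"
    and v: "v \<in> interior (upper_subderivative_dom f)"
  obtains e R M s where "0 < e" "0 < s"
    "\<And>x t y. f x < \<infinity> \<Longrightarrow> M \<le> norm x \<Longrightarrow> 0 < t \<Longrightarrow> t < s \<Longrightarrow> y \<in> cball v e \<Longrightarrow>
       f (x + t *\<^sub>R y) \<le> f x + ereal (t * R)"
proof -
  from v obtain e0 where e0: "e0 > 0" "cball v e0 \<subseteq> upper_subderivative_dom f"
    unfolding mem_interior_cball by blast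
  \<comment> \<open>The radius is halved because the directions \<open>2 *\<^sub>R u - v\<close>
    aimed at below deviate from \<open>v\<close> twice as much as \<open>u\<close>.\<close>
  define e where "e = e0 / 2"
  have e: "e > 0" "cball v (2 * e) \<subseteq> upper_subderivative_dom f"
    using e0 by (auto simp: e_def)
  have "\<forall>w\<in>cball v (2 * e). \<exists>r. descent_rate f w r"
    using e(2) descent_rate_exists[of f, OF f] by blast
  then obtain r where r: "\<And>w. w \<in> cball v (2 * e) \<Longrightarrow> descent_rate f w (r w)"
    by metis
  \<comment> \<open>Rates and thresholds may vary wildly with the direction; compactness leaves
    finitely many of them, which have common bounds.\<close>
  obtain F where F: "F \<subseteq> cball v (2 * e)" "finite F" "cball v (2 * e) \<subseteq> (\<Union>w\<in>F. ball w (e / 2))"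
  proof (rule compactE_image[OF compact_cball, of "cball v (2 * e)" "\<lambda>w. ball w (e / 2)" v "2 * e"])
    show "cball v (2 * e) \<subseteq> (\<Union>w\<in>cball v (2 * e). ball w (e / 2))"
      using e(1) by (auto intro!: bexI)
  qed auto
  \<comment> \<open>Inserting 0 gives \<open>0 \<le> R\<close>, so that the cost of a partial move
    never exceeds \<open>t * R\<close>.\<close>
  define R where "R = Max (insert 0 (r ` F))"
  have R: "0 \<le> R" "\<And>w. w \<in> F \<Longrightarrow> r w \<le> R"
    using F(2) by (auto simp: R_def)
  have "\<forall>\<^sub>F p in infinity_filter f. \<forall>w\<in>F.
      \<exists>u\<in>cball w (e / 2). f (fst p + snd p *\<^sub>R u) \<le> f (fst p) + ereal (snd p * r w)"
  proof (intro eventually_ball_finite F(2) ballI)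
    fix w assume "w \<in> F"
    then have "descent_rate f w (r w)"
      using F(1) r by blast
    moreover have "0 < e / 2"
      using e(1) by simp
    ultimately show "\<forall>\<^sub>F p in infinity_filter f.
        \<exists>u\<in>cball w (e / 2). f (fst p + snd p *\<^sub>R u) \<le> f (fst p) + ereal (snd p * r w)"
      unfolding descent_rate_def case_prod_beta by blast
  qed
  then obtain M s where Ms: "0 < s"
    "\<And>x t w. f x < \<infinity> \<Longrightarrow> M \<le> norm x \<Longrightarrow> 0 < t \<Longrightarrow> t < s \<Longrightarrow> w \<in> F \<Longrightarrow>
       \<exists>u\<in>cball w (e / 2). f (x + t *\<^sub>R u) \<le> f x + ereal (t * r w)"
    unfolding eventually_infinity_filter fst_conv snd_conv by metis
  \<comment> \<open>The error \<open>e\<close> is made up of \<open>e / 2\<close> from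
    \<open>w\<close> to a centre in \<open>F\<close> and \<open>e / 2\<close> from that centre to
    the direction obtained.\<close>
  have step: "\<exists>u\<in>cball w e. f (x + t *\<^sub>R u) \<le> f x + ereal (t * R)"
    if "f x < \<infinity>" "M \<le> norm x" "0 < t" "t < s" "w \<in> cball v (2 * e)" for x t w
  proof -
    from that(5) F(3) obtain w' where w': "w' \<in> F" "dist w' w < e / 2"
      by auto
    from Ms(2)[OF that(1-4) w'(1)] obtain u where u: "dist w' u \<le> e / 2"
      "f (x + t *\<^sub>R u) \<le> f x + ereal (t * r w')"
      by auto
    have "dist w u \<le> e"
      using w'(2) u(1) dist_triangle3[of w u w'] by simp
    moreover have "f x + ereal (t * r w') \<le> f x + ereal (t * R)"
      using R(2)[OF w'(1)] \<open>0 < t\<close> by (intro add_left_mono) simp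
    ultimately show ?thesis
      using u(2) by (intro bexI[of _ u]) (auto intro: order_trans)
  qed
  show thesis
  proof (rule that[OF e(1) Ms(1)])
    \<comment> \<open>The threshold exceeds \<open>M\<close> by two displacements of length at most
      \<open>s * (norm v + e)\<close>: one from \<open>x\<close> to the target \<open>z\<close>, one
      from \<open>z\<close> back to any intermediate point.\<close>
    fix x t y
    assume x: "f x < \<infinity>" "M + 2 * s * (norm v + e) \<le> norm x" and t: "0 < t" "t < s"
      and y: "y \<in> cball v e"
    define z where "z = x + t *\<^sub>R y"
    have ball_norm: "norm u \<le> norm v + e" if "u \<in> cball v e" for u
      using that norm_triangle_sub[of u v] by (auto simp: dist_norm norm_minus_commute)
    have scaled_norm: "norm (c *\<^sub>R u) \<le> s * (norm v + e)"
      if "u \<in> cball v e" "0 \<le> c" "c \<le> t" for u c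
      using ball_norm[OF that(1)] that(2,3) t by (auto intro!: mult_mono)
    have norm_z: "M + s * (norm v + e) \<le> norm z"
      using x(2) scaled_norm[OF y, of t] t norm_diff_ineq[of x "t *\<^sub>R y"]
      by (simp add: z_def)
    \<comment> \<open>Intermediate points are written backwards from the target: a distance
      \<open>t / 2 ^ k\<close> remains in direction \<open>u\<close>, which stays within
      \<open>e\<close> of \<open>v\<close>, and only the part \<open>t - t / 2 ^ k\<close> has been
      paid for.\<close>
    have approx: "\<exists>u\<in>cball v e. f (z - (t / 2 ^ k) *\<^sub>R u) \<le> f x + ereal ((t - t / 2 ^ k) * R)" for k
    proof (induction k)
      case 0
      show ?case using y by (intro bexI[of _ y]) (auto simp: z_def)
    next
      case (Suc k)
      define c where "c = t / 2 ^ Suc k"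
      have c: "0 < c" "t / 2 ^ k = 2 * c" "2 * c \<le> t"
        using t by (auto simp: c_def field_simps)
      from Suc c obtain u where u: "u \<in> cball v e"
        "f (z - (2 * c) *\<^sub>R u) \<le> f x + ereal ((t - 2 * c) * R)"
        by auto
      let ?x = "z - (2 * c) *\<^sub>R u"
      have "norm z \<le> norm ?x + norm ((2 * c) *\<^sub>R u)"
        by (metis diff_add_cancel norm_triangle_ineq)
      then have "M \<le> norm ?x"
        using norm_z scaled_norm[OF u(1), of "2 * c"] c by simp
      moreover have "f ?x < \<infinity>"
        using u(2) x(1) by (auto simp: less_top[symmetric] intro: le_less_trans)
      moreover have "2 *\<^sub>R u - v \<in> cball v (2 * e)"
      proof -
        have "2 *\<^sub>R u - v - v = 2 *\<^sub>R (u - v)"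
          by (simp add: algebra_simps scaleR_2)
        then have "norm (2 *\<^sub>R u - v - v) = 2 * norm (u - v)"
          by simp
        then show ?thesis
          using u(1) by (simp add: dist_norm norm_minus_commute)
      qed
      ultimately obtain u' where u': "u' \<in> cball (2 *\<^sub>R u - v) e"
        "f (?x + c *\<^sub>R u') \<le> f ?x + ereal (c * R)"
        using step[of ?x c "2 *\<^sub>R u - v"] c t by auto
      \<comment> \<open>After the step the remaining direction is \<open>2 *\<^sub>R u - u'\<close>;
        its deviation from \<open>v\<close> is, up to sign, the error of \<open>u'\<close> as an
        approximation of \<open>2 *\<^sub>R u - v\<close>.\<close>
      have eq: "?x + c *\<^sub>R u' = z - c *\<^sub>R (2 *\<^sub>R u - u')"
        by (simp add: algebra_simps)
      have "f (?x + c *\<^sub>R u') \<le> f x + ereal ((t - c) * R)"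
      proof -
        note u'(2)
        also have "f ?x + ereal (c * R) \<le> f x + ereal ((t - 2 * c) * R) + ereal (c * R)"
          using u(2) by (rule add_right_mono)
        also have "\<dots> = f x + ereal ((t - c) * R)"
          by (cases "f x") (auto simp: algebra_simps)
        finally show ?thesis .
      qed
      moreover have "v - (2 *\<^sub>R u - u') = - (2 *\<^sub>R u - v - u')"
        by simp
      then have "2 *\<^sub>R u - u' \<in> cball v e"
        using u'(1) by (simp only: mem_cball dist_norm norm_minus_cancel)
      ultimately show ?case
        unfolding c_def[symmetric] eq by blast
    qed
    then obtain u where u: "\<And>k. u k \<in> cball v e"
      "\<And>k. f (z - (t / 2 ^ k) *\<^sub>R u k) \<le> f x + ereal ((t - t / 2 ^ k) * R)"
      by metis
    \<comment> \<open>The points approach \<open>z\<close> without necessarily reaching it; lower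
      semicontinuity carries the bound over to \<open>z\<close>.\<close>
    have "(\<lambda>k. t / 2 ^ k) \<longlonglongrightarrow> 0"
      using LIMSEQ_divide_realpow_zero[of 2 t] by simp
    then have "(\<lambda>k. (t / 2 ^ k) *\<^sub>R u k) \<longlonglongrightarrow> 0"
      by (rule lim_null_scaleR_bounded[where B = "norm v + e"]) (use ball_norm u(1) in auto)
    then have "(\<lambda>k. z - (t / 2 ^ k) *\<^sub>R u k) \<longlonglongrightarrow> z"
      using tendsto_diff[OF tendsto_const[of z]] by fastforce
    moreover have "f (z - (t / 2 ^ k) *\<^sub>R u k) \<le> f x + ereal (t * R)" for k
    proof -
      have "(t - t / 2 ^ k) * R \<le> t * R"
        using R(1) t by (intro mult_right_mono) auto
      then have "f x + ereal ((t - t / 2 ^ k) * R) \<le> f x + ereal (t * R)"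
        by (intro add_left_mono) simp
      with u(2) show ?thesis by (rule order_trans)
    qed
    ultimately show "f (x + t *\<^sub>R y) \<le> f x + ereal (t * R)"
      unfolding z_def[symmetric] by (rule lower_semicontinuous_sequentially[OF lsc])
  qed
qed

section \<open>The sum rule for descent rates and subderivatives\<close>

lemma descent_rate_add:
  fixes f1 f2 :: "'a::euclidean_space \<Rightarrow> ereal"
  assumes f1: "\<And>x. f1 x \<noteq> -\<infinity>" and f2: "\<And>x. f2 x \<noteq> -\<infinity>"
    and lsc: "lower_semicontinuous f2"
    and v0: "v0 \<in> interior (upper_subderivative_dom f2)" "descent_rate f1 v0 r0"
    and v: "descent_rate f1 v r1" "descent_rate f2 v r2" and "0 < d"
  shows "descent_rate (\<lambda>x. f1 x + f2 x) v (r1 + r2 + d)"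
  unfolding descent_rate_def
proof (intro allI impI)
  fix e :: real assume "0 < e"
  obtain e0 R M0 s0 where unif: "0 < e0" "0 < s0"
    "\<And>x t y. f2 x < \<infinity> \<Longrightarrow> M0 \<le> norm x \<Longrightarrow> 0 < t \<Longrightarrow> t < s0 \<Longrightarrow> y \<in> cball v0 e0 \<Longrightarrow>
       f2 (x + t *\<^sub>R y) \<le> f2 x + ereal (t * R)"
    by (rule uniform_descent_on_interior[OF f2 lsc v0(1)]) blast
  \<comment> \<open>The combined rate is \<open>(1 - m) * (r1 + r2) + m * (r0 + R)\<close>, so the
    third condition keeps its excess over \<open>r1 + r2\<close> within \<open>d\<close>. The fourth
    limits the turn of the overall direction caused by the second move.\<close>
  obtain m where m: "0 < m" "m < 1" "m * (r0 + R - r1 - r2) \<le> d"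
    "m * (e0 + norm v0 + norm v) \<le> e / 2"
  proof -
    have small: "\<forall>\<^sub>F m in at_right 0. m * a < b" if "0 < b" for a b :: real
    proof (rule order_tendstoD)
      show "((\<lambda>m. m * a) \<longlongrightarrow> 0) (at_right 0)"
        by (auto intro!: tendsto_eq_intros)
    qed fact
    have "\<forall>\<^sub>F m in at_right 0. m \<in> {0<..<1} \<and> m * (r0 + R - r1 - r2) < d \<and>
        m * (e0 + norm v0 + norm v) < e / 2"
      using \<open>0 < d\<close> \<open>0 < e\<close> by (intro eventually_conj eventually_at_right_real small) auto
    then show thesis
      by (rule eventually_happens'[OF trivial_limit_at_right_real, THEN exE])
        (use that in \<open>auto intro: less_imp_le\<close>)
  qed
  \<comment> \<open>The first moves for \<open>f1\<close> and \<open>f2\<close> may differ by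
    \<open>2 * e'\<close> in direction. The correction scales this by \<open>(1 - m) / m\<close>,
    and the bound \<open>m * e0 / 4\<close> keeps the result within \<open>e0 / 2\<close>.\<close>
  define e' where "e' = min (e / 2) (m * e0 / 4)"
  have e': "0 < e'" "e' \<le> e / 2" "2 * e' \<le> m * e0 / 2"
    using \<open>0 < e\<close> unif(1) m(1) by (auto simp: e'_def)
  obtain M1 s1 where A1: "0 < s1"
    "\<And>x t. f1 x < \<infinity> \<Longrightarrow> M1 \<le> norm x \<Longrightarrow> 0 < t \<Longrightarrow> t < s1 \<Longrightarrow>
       \<exists>w\<in>cball v e'. f1 (x + t *\<^sub>R w) \<le> f1 x + ereal (t * r1)"
    by (rule descent_rateE[OF v(1) e'(1)]) blast
  obtain M2 s2 where A2: "0 < s2"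
    "\<And>x t. f2 x < \<infinity> \<Longrightarrow> M2 \<le> norm x \<Longrightarrow> 0 < t \<Longrightarrow> t < s2 \<Longrightarrow>
       \<exists>w\<in>cball v e'. f2 (x + t *\<^sub>R w) \<le> f2 x + ereal (t * r2)"
    by (rule descent_rateE[OF v(2) e'(1)]) blast
  obtain M3 s3 where A3: "0 < s3"
    "\<And>x t. f1 x < \<infinity> \<Longrightarrow> M3 \<le> norm x \<Longrightarrow> 0 < t \<Longrightarrow> t < s3 \<Longrightarrow>
       \<exists>w\<in>cball v0 (e0 / 2). f1 (x + t *\<^sub>R w) \<le> f1 x + ereal (t * r0)"
    by (rule descent_rateE[OF v0(2), of "e0 / 2"]) (use unif(1) in auto)
  define s where "s = min (min s0 s1) (min s2 s3)"
  define M where "M = max (max M0 M1) (max M2 M3)"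
  have s: "0 < s" "s \<le> s0" "s \<le> s1" "s \<le> s2" "s \<le> s3"
    using unif(2) A1(1) A2(1) A3(1) by (auto simp: s_def)
  have M: "M0 \<le> M" "M1 \<le> M" "M2 \<le> M" "M3 \<le> M"
    by (auto simp: M_def)
  \<comment> \<open>The margin over \<open>M\<close> keeps the points after the first move beyond
    \<open>M\<close>, where the second move can start.\<close>
  have main: "\<exists>w\<in>cball v e. f1 (x + t *\<^sub>R w) + f2 (x + t *\<^sub>R w)
      \<le> f1 x + f2 x + ereal (t * (r1 + r2 + d))"
    if x: "f1 x + f2 x < \<infinity>" "M + s * (norm v + e') \<le> norm x" and t: "0 < t" "t < s" for x t
  proof -
    define c where "c = (1 - m) * t"
    have mt: "0 < m * t" "m * t < s" and c: "0 < c" "c < s" "c \<le> t"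
    proof -
      show "0 < m * t" "0 < c"
        using m t by (auto simp: c_def)
      show "c \<le> t"
        using m t mult_left_le_one_le[of t "1 - m"] by (auto simp: c_def)
      then show "c < s" using t by simp
      have "m * t \<le> t"
        using m t mult_left_le_one_le[of t m] by auto
      then show "m * t < s" using t(2) by (rule le_less_trans)
    qed
    have norm_moved: "M \<le> norm (x + c *\<^sub>R w)" if "w \<in> cball v e'" for w
    proof -
      have "norm w \<le> norm v + e'"
        using that norm_triangle_sub[of w v] by (auto simp: dist_norm norm_minus_commute)
      then have "norm (c *\<^sub>R w) \<le> s * (norm v + e')"
        using c by (auto intro!: mult_mono)
      then show ?thesis
        using x(2) norm_diff_ineq[of x "c *\<^sub>R w"] by simp
    qed
    have "0 \<le> s * (norm v + e')"
      using s(1) e'(1) by simp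
    then have Mx: "M \<le> norm x"
      using x(2) by simp
    obtain a1 where a1: "f1 x = ereal a1"
      using x(1) f1[of x] by (cases "f1 x") auto
    obtain a2 where a2: "f2 x = ereal a2"
      using x(1) f2[of x] by (cases "f2 x") auto
    obtain w1 where w1: "w1 \<in> cball v e'" "f1 (x + c *\<^sub>R w1) \<le> ereal (a1 + c * r1)"
      using A1(2)[of x c] a1 Mx M s c by auto
    obtain w2 where w2: "w2 \<in> cball v e'" "f2 (x + c *\<^sub>R w2) \<le> ereal (a2 + c * r2)"
      using A2(2)[of x c] a2 Mx M s c by auto
    have "f1 (x + c *\<^sub>R w1) < \<infinity>" "f2 (x + c *\<^sub>R w2) < \<infinity>"
      using w1(2) w2(2) by (auto intro: le_less_trans)
    then obtain b1 b2 where b1: "f1 (x + c *\<^sub>R w1) = ereal b1" "b1 \<le> a1 + c * r1"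
      and b2: "f2 (x + c *\<^sub>R w2) = ereal b2" "b2 \<le> a2 + c * r2"
      using w1(2) w2(2) f1[of "x + c *\<^sub>R w1"] f2[of "x + c *\<^sub>R w2"]
      by (cases "f1 (x + c *\<^sub>R w1)"; cases "f2 (x + c *\<^sub>R w2)") auto
    obtain u where u: "u \<in> cball v0 (e0 / 2)"
      "f1 (x + c *\<^sub>R w1 + (m * t) *\<^sub>R u) \<le> ereal (b1 + m * t * r0)"
      using A3(2)[of "x + c *\<^sub>R w1" "m * t"] b1 norm_moved[OF w1(1)] M s mt by auto
    \<comment> \<open>Chosen so that moving by \<open>m * t\<close> along \<open>y\<close> from the
      first-move point of \<open>f2\<close> ends exactly where \<open>u\<close> takes
      \<open>f1\<close>. Half of the radius \<open>e0\<close> is used by \<open>u\<close>, the other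
      half by the correction.\<close>
    define y where "y = u + ((1 - m) / m) *\<^sub>R (w1 - w2)"
    have "norm (w1 - w2) \<le> 2 * e'"
      using w1(1) w2(1) norm_triangle_ineq4[of "w1 - v" "w2 - v"]
      by (simp add: dist_norm norm_minus_commute)
    then have "(1 - m) * norm (w1 - w2) \<le> 1 * (2 * e')"
      using m by (intro mult_mono) auto
    also note e'(3)
    finally have "(1 - m) * norm (w1 - w2) / m \<le> e0 / 2"
      using m by (simp add: divide_le_eq mult.commute)
    moreover have "norm (((1 - m) / m) *\<^sub>R (w1 - w2)) = (1 - m) * norm (w1 - w2) / m"
      using m by (simp only: norm_scaleR) simp
    moreover have "y - v0 = (u - v0) + ((1 - m) / m) *\<^sub>R (w1 - w2)"
      by (simp add: y_def)
    moreover have "norm (u - v0) \<le> e0 / 2"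
      using u(1) by (simp add: dist_norm norm_minus_commute)
    ultimately have "norm (y - v0) \<le> e0 / 2 + e0 / 2"
      by (metis add_mono norm_triangle_ineq order_trans)
    then have "y \<in> cball v0 e0"
      by (simp add: dist_norm norm_minus_commute)
    then have "f2 (x + c *\<^sub>R w2 + (m * t) *\<^sub>R y) \<le> ereal (b2 + m * t * R)"
      using unif(3)[of "x + c *\<^sub>R w2" "m * t" y] b2 norm_moved[OF w2(1)] M s mt by auto
    moreover
    have "m * t * ((1 - m) / m) = c"
      using m by (simp add: c_def)
    then have "(m * t) *\<^sub>R y = (m * t) *\<^sub>R u + c *\<^sub>R (w1 - w2)"
      by (simp only: y_def scaleR_right_distrib scaleR_scaleR)
    then have "x + c *\<^sub>R w2 + (m * t) *\<^sub>R y = x + c *\<^sub>R w1 + (m * t) *\<^sub>R u"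
      by (simp add: scaleR_right_diff_distrib)
    moreover define w where "w = (1 - m) *\<^sub>R w1 + m *\<^sub>R u"
    have "x + c *\<^sub>R w1 + (m * t) *\<^sub>R u = x + t *\<^sub>R w"
      unfolding c_def w_def by (simp add: algebra_simps)
    ultimately have "f1 (x + t *\<^sub>R w) + f2 (x + t *\<^sub>R w)
        \<le> ereal (b1 + m * t * r0) + ereal (b2 + m * t * R)"
      using u(2) by (intro add_mono) (simp_all only:)
    also have "\<dots> \<le> ereal (a1 + a2 + t * (r1 + r2 + d))"
    proof -
      have "t * (m * (r0 + R - r1 - r2)) \<le> t * d"
        using m(3) t by (intro mult_left_mono) auto
      then show ?thesis
        using b1(2) b2(2) by (simp add: c_def algebra_simps)
    qed
    also have "\<dots> = f1 x + f2 x + ereal (t * (r1 + r2 + d))"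
      by (simp add: a1 a2)
    finally have "f1 (x + t *\<^sub>R w) + f2 (x + t *\<^sub>R w) \<le> f1 x + f2 x + ereal (t * (r1 + r2 + d))" .
    moreover have "w \<in> cball v e"
    proof -
      have "w - v = (1 - m) *\<^sub>R (w1 - v) + m *\<^sub>R (u - v)"
        by (simp add: w_def algebra_simps)
      then have "norm (w - v) \<le> (1 - m) * norm (w1 - v) + m * norm (u - v)"
        using m by (metis abs_of_nonneg diff_ge_0_iff_ge less_imp_le norm_scaleR norm_triangle_ineq)
      also have "(1 - m) * norm (w1 - v) \<le> 1 * (e / 2)"
        using m w1(1) e' by (intro mult_mono) (auto simp: dist_norm norm_minus_commute)
      also have "m * norm (u - v) \<le> m * (e0 + norm v0 + norm v)"
      proof (intro mult_left_mono)
        have "norm u \<le> norm v0 + e0"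
          using u(1) norm_triangle_sub[of u v0] unif(1) by (auto simp: dist_norm norm_minus_commute)
        then show "norm (u - v) \<le> e0 + norm v0 + norm v"
          using norm_triangle_ineq4[of u v] by simp
      qed (use m in simp)
      finally show ?thesis
        using m(4) by (simp add: dist_norm norm_minus_commute)
    qed
    ultimately show ?thesis by blast
  qed
  show "\<forall>\<^sub>F (x, t) in infinity_filter (\<lambda>x. f1 x + f2 x). \<exists>w\<in>cball v e.
      f1 (x + t *\<^sub>R w) + f2 (x + t *\<^sub>R w) \<le> f1 x + f2 x + ereal (t * (r1 + r2 + d))"
    unfolding eventually_infinity_filter using main s(1)
    by (intro exI[of _ "M + s * (norm v + e')"] exI[of _ s]) auto
qed

text \<open>A sum below a real has no summand equal to plus infinity, and a summand minus infinity
  can be bounded by a real as low as required.\<close>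

lemma ereal_sum_less_split:
  fixes a b :: ereal
  assumes "a + b < ereal z"
  obtains r1 r2 where "a < ereal r1" "b < ereal r2" "r1 + r2 < z"
proof -
  consider (real) p q where "a = ereal p" "b = ereal q" | (left) q where "a = -\<infinity>" "b = ereal q"
    | (right) p where "a = ereal p" "b = -\<infinity>" | (both) "a = -\<infinity>" "b = -\<infinity>"
    using assms by (cases a; cases b) auto
  then show thesis
  proof cases
    case real
    \<comment> \<open>Each summand takes a third of the gap; the last third keeps the final
      inequality strict.\<close>
    then show ?thesis
      using assms that[of "p + (z - p - q) / 3" "q + (z - p - q) / 3"] by (simp add: field_simps)
  next
    case left
    then show ?thesis using that[of "z - q - 2" "q + 1"] by simp
  next
    case right
    then show ?thesis using that[of "p + 1" "z - p - 2"] by simp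
  next
    case both
    then show ?thesis using that[of 0 "z - 1"] by simp
  qed
qed

text \<open>Testing against real upper bounds \<open>z\<close> of the right-hand side handles its
  infinite values as well. The slack \<open>d\<close> makes room for real rates strictly above both
  subderivatives.\<close>

lemma upper_subderivative_infinity_add_le:
  fixes f1 f2 :: "'a::euclidean_space \<Rightarrow> ereal"
  assumes f1: "\<And>x. f1 x \<noteq> -\<infinity>" and f2: "\<And>x. f2 x \<noteq> -\<infinity>"
    and lsc: "lower_semicontinuous f2"
    and v0: "v0 \<in> upper_subderivative_dom f1" "v0 \<in> interior (upper_subderivative_dom f2)"
  shows "upper_subderivative_infinity (\<lambda>x. f1 x + f2 x) v
    \<le> upper_subderivative_infinity f1 v + upper_subderivative_infinity f2 v"
proof (rule ereal_le_real)
  fix z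
  assume z: "upper_subderivative_infinity f1 v + upper_subderivative_infinity f2 v \<le> ereal z"
  obtain r0 where r0: "descent_rate f1 v0 r0"
    by (rule descent_rate_exists[of f1, OF f1 v0(1)])
  have "upper_subderivative_infinity (\<lambda>x. f1 x + f2 x) v \<le> ereal (z + d)" if "0 < d" for d
  proof -
    have "upper_subderivative_infinity f1 v + upper_subderivative_infinity f2 v < ereal (z + d)"
      using z that by (auto intro: le_less_trans)
    then obtain r1 r2 where r: "upper_subderivative_infinity f1 v < ereal r1"
      "upper_subderivative_infinity f2 v < ereal r2" "r1 + r2 < z + d"
      by (rule ereal_sum_less_split)
    then have "0 < z + d - (r1 + r2)" by simp
    from descent_rate_add[OF f1 f2 lsc v0(2) r0
        descent_rate_if_upper_subderivative_less[OF f1 r(1)]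
        descent_rate_if_upper_subderivative_less[OF f2 r(2)] this]
    show ?thesis
      using upper_subderivative_le_if_descent_rate[of "\<lambda>x. f1 x + f2 x" v "z + d"] f1 f2 by simp
  qed
  then show "upper_subderivative_infinity (\<lambda>x. f1 x + f2 x) v \<le> ereal z"
    by (metis ereal_le_epsilon2 plus_ereal.simps(1))
qed

section \<open>The tangent cone at infinity and its relation to descent rates\<close>

lemma selection_tendsto:
  fixes z :: "'a::metric_space"
  assumes ne: "\<And>k. \<exists>w. P k w"
    and near: "\<And>e. 0 < e \<Longrightarrow> \<forall>\<^sub>F k in sequentially. \<exists>w. P k w \<and> dist w z \<le> e"
  obtains w where "w \<longlonglongrightarrow> z" "\<And>k. P k (w k)"
proof -
  \<comment> \<open>Choosing nearly the closest admissible point at each index serves all tolerances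
    at once; \<open>1 / Suc k\<close> makes up for an infimal distance that is not attained.\<close>
  define D where "D k = infdist z {w. P k w}" for k
  have "\<exists>w. P k w \<and> dist w z < D k + 1 / Suc k" for k
  proof -
    have "D k = Inf (dist z ` {w. P k w})"
      using ne[of k] by (simp add: D_def infdist_notempty)
    then have "Inf (dist z ` {w. P k w}) < D k + 1 / Suc k"
      by simp
    moreover have "dist z ` {w. P k w} \<noteq> {}"
      using ne[of k] by blast
    ultimately obtain d where "d \<in> dist z ` {w. P k w}" "d < D k + 1 / Suc k"
      using cInf_lessD by meson
    then show ?thesis
      by (auto simp only: image_iff mem_Collect_eq dist_commute)
  qed
  then obtain w where w: "\<And>k. P k (w k)" "\<And>k. dist (w k) z < D k + 1 / Suc k"
    by metis
  have "D \<longlonglongrightarrow> 0"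
  proof (rule tendstoI)
    fix e :: real assume "0 < e"
    then have "\<forall>\<^sub>F k in sequentially. \<exists>w. P k w \<and> dist w z \<le> e / 2"
      by (intro near) simp
    then show "\<forall>\<^sub>F k in sequentially. dist (D k) 0 < e"
    proof eventually_elim
      case (elim k)
      then obtain u where "P k u" "dist u z \<le> e / 2" by blast
      then have "D k \<le> e / 2"
        unfolding D_def by (intro infdist_le2[of u]) (auto simp: dist_commute)
      then show ?case using \<open>0 < e\<close> infdist_nonneg[of z "{w. P k w}"] by (simp add: D_def)
    qed
  qed
  then have "(\<lambda>k. D k + 1 / Suc k) \<longlonglongrightarrow> 0 + 0"
    by (intro tendsto_add) (use LIMSEQ_Suc[OF lim_const_over_n[of 1]] in simp_all)
  then have "(\<lambda>k. dist (w k) z) \<longlonglongrightarrow> 0"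
    by (intro Lim_null_comparison[of "\<lambda>k. dist (w k) z" "\<lambda>k. D k + 1 / Suc k"])
      (auto intro!: always_eventually less_imp_le[OF w(2)] simp del: of_nat_Suc)
  then have "w \<longlonglongrightarrow> z"
    by (simp add: tendsto_dist_iff[of w z])
  with w(1) that show thesis by blast
qed

lemma tangent_cone_infinityE:
  assumes "z \<in> tangent_cone_infinity C"
    and "\<And>k. p k \<in> C" "filterlim (\<lambda>k. norm (fst (p k))) at_top sequentially"
    and "\<And>k. 0 < t k" "decseq t" "t \<longlonglongrightarrow> 0"
  obtains w where "w \<longlonglongrightarrow> z" "\<And>k. p k + t k *\<^sub>R w k \<in> C"
  using assms unfolding tangent_cone_infinity_def by blast

lemma zero_in_tangent_cone_infinity: "0 \<in> tangent_cone_infinity C"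
  unfolding tangent_cone_infinity_def by (auto intro!: exI[of _ "\<lambda>_. 0"])

text \<open>The factor is absorbed into the step sizes, since \<open>t k * c\<close> is again an
  admissible sequence.\<close>

lemma tangent_cone_infinity_scaleR:
  assumes "z \<in> tangent_cone_infinity C" "0 < c"
  shows "c *\<^sub>R z \<in> tangent_cone_infinity C"
  unfolding tangent_cone_infinity_def
proof (clarify)
  fix p :: "nat \<Rightarrow> 'a \<times> real" and t :: "nat \<Rightarrow> real"
  assume p: "\<forall>k. p k \<in> C" "filterlim (\<lambda>k. norm (fst (p k))) at_top sequentially"
    and t: "\<forall>k. 0 < t k" "decseq t" "t \<longlonglongrightarrow> 0"
  obtain w where w: "w \<longlonglongrightarrow> z" "\<And>k. p k + (t k * c) *\<^sub>R w k \<in> C"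
  proof (rule tangent_cone_infinityE[OF assms(1), of p "\<lambda>k. t k * c"])
    show "decseq (\<lambda>k. t k * c)"
      using t(2) \<open>0 < c\<close> by (auto simp: decseq_def)
    show "(\<lambda>k. t k * c) \<longlonglongrightarrow> 0"
      using t(3) by (rule tendsto_mult_left_zero)
  qed (use p t \<open>0 < c\<close> in auto)
  show "\<exists>w. w \<longlonglongrightarrow> c *\<^sub>R z \<and> (\<forall>k. p k + t k *\<^sub>R w k \<in> C)"
    using w by (intro exI[of _ "\<lambda>k. c *\<^sub>R w k"]) (auto intro: tendsto_intros)
qed

text \<open>The two tangent moves are made one after the other: the endpoints of the first lie in
  \<open>C\<close> and serve as base points of the second.\<close>

lemma tangent_cone_infinity_add:
  assumes "z \<in> tangent_cone_infinity C" "z' \<in> tangent_cone_infinity C"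
  shows "z + z' \<in> tangent_cone_infinity C"
  unfolding tangent_cone_infinity_def
proof (clarify)
  fix p :: "nat \<Rightarrow> 'a \<times> real" and t :: "nat \<Rightarrow> real"
  assume p: "\<forall>k. p k \<in> C" "filterlim (\<lambda>k. norm (fst (p k))) at_top sequentially"
    and t: "\<forall>k. 0 < t k" "decseq t" "t \<longlonglongrightarrow> 0"
  obtain w where w: "w \<longlonglongrightarrow> z" "\<And>k. p k + t k *\<^sub>R w k \<in> C"
    by (rule tangent_cone_infinityE[OF assms(1), of p t]) (use p t in auto)
  \<comment> \<open>The first displacement tends to 0, so the new base points still go to
    infinity.\<close>
  have "(\<lambda>k. - norm (fst (t k *\<^sub>R w k))) \<longlonglongrightarrow> - norm (fst (0 *\<^sub>R z))"
    using t(3) w(1) by (intro tendsto_intros)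
  then have "filterlim (\<lambda>k. - norm (fst (t k *\<^sub>R w k)) + norm (fst (p k))) at_top sequentially"
    by (rule filterlim_tendsto_add_at_top[OF _ p(2)])
  then have "filterlim (\<lambda>k. norm (fst (p k + t k *\<^sub>R w k))) at_top sequentially"
  proof (rule filterlim_at_top_mono, intro always_eventually allI)
    fix k
    show "- norm (fst (t k *\<^sub>R w k)) + norm (fst (p k)) \<le> norm (fst (p k + t k *\<^sub>R w k))"
      using norm_diff_ineq[of "fst (p k)" "fst (t k *\<^sub>R w k)"] by simp
  qed
  then obtain w' where w': "w' \<longlonglongrightarrow> z'" "\<And>k. p k + t k *\<^sub>R w k + t k *\<^sub>R w' k \<in> C"
    by (rule tangent_cone_infinityE[OF assms(2), of "\<lambda>k. p k + t k *\<^sub>R w k" t, rotated])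
      (use w(2) t in auto)
  show "\<exists>w. w \<longlonglongrightarrow> z + z' \<and> (\<forall>k. p k + t k *\<^sub>R w k \<in> C)"
    using w w' by (intro exI[of _ "\<lambda>k. w k + w' k"])
      (auto intro: tendsto_add simp: scaleR_add_right add.assoc)
qed

lemma convex_tangent_cone_infinity: "convex (tangent_cone_infinity C)"
proof (rule convexI)
  fix y z and a b :: real
  assume *: "y \<in> tangent_cone_infinity C" "z \<in> tangent_cone_infinity C" "0 \<le> a" "0 \<le> b"
  have "c *\<^sub>R x \<in> tangent_cone_infinity C" if "x \<in> tangent_cone_infinity C" "0 \<le> c" for c x
    using that tangent_cone_infinity_scaleR[of x C c] zero_in_tangent_cone_infinity[of C]
    by (cases "c = 0") auto
  with * show "a *\<^sub>R y + b *\<^sub>R z \<in> tangent_cone_infinity C"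
    by (intro tangent_cone_infinity_add)
qed

text \<open>A descent rate gives, for each tolerance, directions at late indices only;
  \<open>selection_tendsto\<close> merges them into one sequence, with the zero vector available at
  early indices.\<close>

lemma tangent_cone_epi_if_descent_rate:
  assumes "descent_rate f v r"
  shows "(v, r) \<in> tangent_cone_infinity (epi f)"
  unfolding tangent_cone_infinity_def
proof (clarify)
  fix p :: "nat \<Rightarrow> 'a \<times> real" and t :: "nat \<Rightarrow> real"
  assume p: "\<forall>k. p k \<in> epi f" "filterlim (\<lambda>k. norm (fst (p k))) at_top sequentially"
    and t: "\<forall>k. 0 < t k" "decseq t" "t \<longlonglongrightarrow> 0"
  have "\<exists>w. w \<longlonglongrightarrow> (v, r) \<and> (\<forall>k. p k + t k *\<^sub>R w k \<in> epi f)"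
  proof (rule selection_tendsto[of "\<lambda>k w. p k + t k *\<^sub>R w \<in> epi f" "(v, r)"])
    fix k
    show "\<exists>w. p k + t k *\<^sub>R w \<in> epi f"
      using p(1) by (intro exI[of _ 0]) simp
  next
    fix e :: real assume "0 < e"
    with assms obtain M s where Ms: "0 < s"
      "\<And>x t. f x < \<infinity> \<Longrightarrow> M \<le> norm x \<Longrightarrow> 0 < t \<Longrightarrow> t < s \<Longrightarrow>
       \<exists>w\<in>cball v e. f (x + t *\<^sub>R w) \<le> f x + ereal (t * r)"
      by (rule descent_rateE) blast
    have "\<forall>\<^sub>F k in sequentially. M \<le> norm (fst (p k))"
      using p(2) by (simp add: filterlim_at_top)
    moreover have "\<forall>\<^sub>F k in sequentially. t k < s"
      using order_tendstoD(2)[OF t(3) Ms(1)] .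
    ultimately show "\<forall>\<^sub>F k in sequentially. \<exists>w. p k + t k *\<^sub>R w \<in> epi f \<and> dist w (v, r) \<le> e"
    proof eventually_elim
      case (elim k)
      obtain x y where xy: "p k = (x, y)" by (cases "p k")
      have y: "f x \<le> ereal y"
        using p(1)[rule_format, of k] xy by (simp add: epi_def)
      then have "f x < \<infinity>" by (rule le_less_trans) simp
      with Ms(2)[of x "t k"] elim t(1) xy obtain w where
        w: "w \<in> cball v e" "f (x + t k *\<^sub>R w) \<le> f x + ereal (t k * r)"
        by auto
      have "f (x + t k *\<^sub>R w) \<le> ereal y + ereal (t k * r)"
        using w(2) add_right_mono[OF y] by (rule order_trans)
      then show ?case
        using w(1) xy by (intro exI[of _ "(w, r)"]) (auto simp: epi_def dist_Pair_Pair dist_commute)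
    qed
  qed blast
  then show "\<exists>w. w \<longlonglongrightarrow> (v, r) \<and> (\<forall>k. p k + t k *\<^sub>R w k \<in> epi f)" .
qed

text \<open>Were \<open>r'\<close> not a rate, there would be base points on the graph, going to
  infinity, where it fails. The tangent sequence at these points has second components tending to
  \<open>r\<close>, hence eventually below \<open>r'\<close>, a contradiction.\<close>

lemma descent_rate_if_tangent_cone_epi:
  assumes f: "\<And>x. f x \<noteq> -\<infinity>" and tan: "(v, r) \<in> tangent_cone_infinity (epi f)" and "r < r'"
  shows "descent_rate f v r'"
proof (rule ccontr)
  assume "\<not> descent_rate f v r'"
  then obtain e where e: "0 < e"
    "\<And>M s. 0 < s \<Longrightarrow> \<exists>x t. f x < \<infinity> \<and> M \<le> norm x \<and> 0 < t \<and> t < s \<and>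
       \<not> (\<exists>w\<in>cball v e. f (x + t *\<^sub>R w) \<le> f x + ereal (t * r'))"
    unfolding descent_rate_def eventually_infinity_filter by auto
  define Q where "Q k xt \<longleftrightarrow> (case xt of (x, t) \<Rightarrow> f x < \<infinity> \<and> real k \<le> norm x \<and> 0 < t \<and>
      t < 1 / Suc k \<and> \<not> (\<exists>w\<in>cball v e. f (x + t *\<^sub>R w) \<le> f x + ereal (t * r')))" for k xt
  \<comment> \<open>Dependent choice is used because the step sizes must decrease: each is picked
    below its predecessor.\<close>
  have "\<exists>g. \<forall>k. Q k (g k) \<and> snd (g (Suc k)) \<le> snd (g k)"
  proof (rule dependent_nat_choice)
    show "\<exists>p. Q 0 p"
      using e(2)[of 1 0] by (auto simp: Q_def)
    fix p k assume "Q k p"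
    then have "0 < min (1 / Suc (Suc k)) (snd p)"
      by (auto simp: Q_def)
    from e(2)[OF this, of "Suc k"] show "\<exists>q. Q (Suc k) q \<and> snd q \<le> snd p"
      unfolding Q_def by (auto simp del: of_nat_Suc intro: less_imp_le)
  qed
  then obtain g where g: "\<And>k. Q k (g k)" "\<And>k. snd (g (Suc k)) \<le> snd (g k)"
    by blast
  define x t where "x k = fst (g k)" and "t k = snd (g k)" for k
  have xt: "f (x k) < \<infinity>" "real k \<le> norm (x k)" "0 < t k" "t k < 1 / Suc k"
    "\<And>w. w \<in> cball v e \<Longrightarrow> \<not> f (x k + t k *\<^sub>R w) \<le> f (x k) + ereal (t k * r')" for k
    using g(1)[of k] by (auto simp: Q_def x_def t_def split: prod.splits)
  have fx: "ereal (real_of_ereal (f (x k))) = f (x k)" for k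
    using xt(1)[of k] f[of "x k"] by (intro ereal_real') auto
  obtain w where w: "w \<longlonglongrightarrow> (v, r)" "\<And>k. (x k, real_of_ereal (f (x k))) + t k *\<^sub>R w k \<in> epi f"
  proof (rule tangent_cone_infinityE[OF tan, of "\<lambda>k. (x k, real_of_ereal (f (x k)))" t])
    show "(x k, real_of_ereal (f (x k))) \<in> epi f" for k
      by (simp add: epi_def fx)
    show "filterlim (\<lambda>k. norm (fst (x k, real_of_ereal (f (x k))))) at_top sequentially"
      using xt(2) by (auto intro!: filterlim_at_top_mono[OF filterlim_real_sequentially] always_eventually)
    show "decseq t"
      using g(2) by (auto simp: decseq_Suc_iff t_def)
    show "t \<longlonglongrightarrow> 0"
      by (rule tendsto_sandwich[OF _ _ tendsto_const LIMSEQ_Suc[OF lim_const_over_n[of 1]]])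
        (auto intro!: always_eventually less_imp_le[OF xt(3)] less_imp_le[OF xt(4)] simp del: of_nat_Suc)
  qed (use xt in auto)
  have "\<forall>\<^sub>F k in sequentially. dist (fst (w k)) v < e"
    using tendsto_fst[OF w(1)] e(1) by (auto dest: tendstoD)
  moreover have "\<forall>\<^sub>F k in sequentially. snd (w k) < r'"
    using tendsto_snd[OF w(1)] \<open>r < r'\<close> by (auto dest: order_tendstoD(2))
  ultimately have "\<forall>\<^sub>F k in sequentially. dist (fst (w k)) v < e \<and> snd (w k) < r'"
    by (rule eventually_conj)
  then obtain k where k: "dist (fst (w k)) v < e" "snd (w k) < r'"
    using eventually_happens'[OF sequentially_bot] by blast
  have "f (x k + t k *\<^sub>R fst (w k)) \<le> ereal (real_of_ereal (f (x k)) + t k * snd (w k))"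
    using w(2)[of k] by (simp add: epi_def case_prod_beta)
  also have "\<dots> \<le> ereal (real_of_ereal (f (x k)) + t k * r')"
    using k(2) xt(3)[of k] by simp
  also have "\<dots> = f (x k) + ereal (t k * r')"
    using fx[of k] by (metis plus_ereal.simps(1))
  finally show False
    using xt(5)[of "fst (w k)" k] k(1) by (simp add: dist_commute)
qed

section \<open>Separation of cones and the inclusion of subdifferentials\<close>

lemma mem_subdifferential_infinity_iff:
  "xi \<in> subdifferential_infinity f \<longleftrightarrow>
    (\<forall>v r. (v, r) \<in> tangent_cone_infinity (epi f) \<longrightarrow> inner v xi \<le> r)"
  by (auto simp: subdifferential_infinity_def normal_cone_infinity_def)

text \<open>A separating hyperplane can be moved to level 0: \<open>0 \<in> A\<close> gives
  \<open>b \<le> 0\<close>, and a negative value on the cone \<open>A\<close> could be scaled below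
  any level.\<close>

lemma separation_of_cones:
  fixes A B :: "'a::euclidean_space set"
  assumes "convex A" "convex B" "A \<inter> B = {}" "0 \<in> A" "B \<noteq> {}"
    and A: "\<And>x c. x \<in> A \<Longrightarrow> 0 < c \<Longrightarrow> c *\<^sub>R x \<in> A"
    and B: "\<And>x c. x \<in> B \<Longrightarrow> 0 < c \<Longrightarrow> c *\<^sub>R x \<in> B"
  obtains a where "a \<noteq> 0" "\<And>x. x \<in> A \<Longrightarrow> 0 \<le> inner a x" "\<And>x. x \<in> B \<Longrightarrow> inner a x \<le> 0"
proof -
  obtain a b where ab: "a \<noteq> 0" "\<forall>x\<in>B. inner a x \<le> b" "\<forall>x\<in>A. b \<le> inner a x"
    using separating_hyperplane_sets[of B A] assms(1-5) by auto
  have b: "b \<le> 0"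
    using ab(3) assms(4) by fastforce
  show thesis
  proof (rule that[OF ab(1)])
    fix x assume "x \<in> B"
    then show "inner a x \<le> 0" using ab(2) b by fastforce
  next
    fix x assume x: "x \<in> A"
    show "0 \<le> inner a x"
    proof (rule ccontr)
      assume neg: "\<not> 0 \<le> inner a x"
      \<comment> \<open>This factor brings the value to \<open>b - 1\<close>; it is positive as a
        quotient of two negative numbers.\<close>
      define c where "c = (b - 1) / inner a x"
      have "0 < c"
        using neg b by (auto simp: c_def divide_neg_neg)
      then have "b \<le> inner a (c *\<^sub>R x)"
        using A[OF x] ab(3) by blast
      also have "\<dots> = b - 1"
        using neg by (simp add: c_def)
      finally show False by simp
    qed
  qed
qed

theorem proposition4p13:
  fixes f1 f2 :: "real ^ 'n \<Rightarrow> ereal"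
  assumes "\<And>x. f1 x \<noteq> -\<infinity>" and "\<And>x. f2 x \<noteq> -\<infinity>"
    and "lower_semicontinuous f1" and "lower_semicontinuous f2"
    and "\<not> bounded (effective_dom f1)" and "\<not> bounded (effective_dom f2)"
    and "\<not> bounded (effective_dom (\<lambda>x. f1 x + f2 x))"
    and "upper_subderivative_dom f1 \<inter> interior (upper_subderivative_dom f2) \<noteq> {}"
  shows "(\<forall>v. upper_subderivative_infinity (\<lambda>x. f1 x + f2 x) v
              \<le> upper_subderivative_infinity f1 v + upper_subderivative_infinity f2 v) \<and>
         subdifferential_infinity (\<lambda>x. f1 x + f2 x)
              \<subseteq> subdifferential_infinity f1 + subdifferential_infinity f2"
proof (intro conjI allI subsetI)
  note f1 = assms(1) and f2 = assms(2) and lsc = assms(4)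
  obtain v0 where v0: "v0 \<in> upper_subderivative_dom f1"
    "v0 \<in> interior (upper_subderivative_dom f2)"
    using assms(8) by blast
  show "upper_subderivative_infinity (\<lambda>x. f1 x + f2 x) v
      \<le> upper_subderivative_infinity f1 v + upper_subderivative_infinity f2 v" for v
    by (rule upper_subderivative_infinity_add_le[OF f1 f2 lsc v0])
  have tangent: "\<exists>r. (v, r) \<in> tangent_cone_infinity (epi f)"
    if "\<And>x. f x \<noteq> -\<infinity>" "v \<in> upper_subderivative_dom f" for v and f :: "real ^ 'n \<Rightarrow> ereal"
    using descent_rate_exists[of f, OF that] tangent_cone_epi_if_descent_rate by metis
  let ?T1 = "tangent_cone_infinity (epi f1)" and ?T2 = "tangent_cone_infinity (epi f2)"
  obtain r0 where r0: "(v0, r0) \<in> ?T1"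
    using tangent[OF f1 v0(1)] by blast
  fix xi assume "xi \<in> subdifferential_infinity (\<lambda>x. f1 x + f2 x)"
  then have xi: "inner v xi \<le> r" if "descent_rate (\<lambda>x. f1 x + f2 x) v r" for v r
    using tangent_cone_epi_if_descent_rate[OF that] by (auto simp: mem_subdifferential_infinity_iff)
  \<comment> \<open>A tangent \<open>(v, r)\<close> only yields rates strictly above
    \<open>r\<close>. The slack \<open>d\<close> is shared in thirds by \<open>f1\<close>,
    \<open>f2\<close> and the sum rule; at \<open>v0\<close> any rate of \<open>f1\<close> will
    do.\<close>
  have xi_le: "inner v xi \<le> r1 + r2" if r: "(v, r1) \<in> ?T1" "(v, r2) \<in> ?T2" for v r1 r2
  proof (rule field_le_epsilon)
    fix d :: real assume "0 < d"
    then have "descent_rate f1 v (r1 + d / 3)" "descent_rate f2 v (r2 + d / 3)"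
      "descent_rate f1 v0 (r0 + 1)" "0 < d / 3"
      using descent_rate_if_tangent_cone_epi[OF f1 r(1)] descent_rate_if_tangent_cone_epi[OF f2 r(2)]
        descent_rate_if_tangent_cone_epi[OF f1 r0] by auto
    from xi[OF descent_rate_add[OF f1 f2 lsc v0(2) this(3,1,2,4)]]
    show "inner v xi \<le> r1 + r2 + d" by simp
  qed
  \<comment> \<open>By \<open>xi_le\<close>, a point \<open>(v, b)\<close> of \<open>?T1\<close>
    satisfies \<open>inner v xi - r \<le> b\<close> whenever \<open>(v, r) \<in> ?T2\<close>; the
    strict inequality here therefore makes \<open>B\<close> disjoint from
    \<open>?T1\<close>.\<close>
  define B where "B = {(v, b). \<exists>r. (v, r) \<in> ?T2 \<and> b < inner v xi - r}"
  have B_add: "y + z \<in> B" if "y \<in> B" "z \<in> B" for y z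
    using that by (fastforce simp: B_def inner_add_left dest: tangent_cone_infinity_add)
  have B_scale: "c *\<^sub>R z \<in> B" if zB: "z \<in> B" and c: "0 < c" for z c
  proof -
    obtain v b r where z: "z = (v, b)" "(v, r) \<in> ?T2" "b < inner v xi - r"
      using zB unfolding B_def by blast
    have "(c *\<^sub>R v, c * r) \<in> ?T2"
      using tangent_cone_infinity_scaleR[OF z(2) c] by simp
    moreover have "c * b < inner (c *\<^sub>R v) xi - c * r"
      using mult_strict_left_mono[OF z(3) c] by (simp add: algebra_simps)
    ultimately show ?thesis
      by (auto simp: z(1) B_def)
  qed
  obtain eta beta where sep: "(eta, beta) \<noteq> 0"
    "\<And>v r. (v, r) \<in> ?T1 \<Longrightarrow> 0 \<le> inner eta v + beta * r"
    "\<And>v b. (v, b) \<in> B \<Longrightarrow> inner eta v + beta * b \<le> 0"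
  proof (rule separation_of_cones[of ?T1 B])
    show "convex B"
    proof (rule convexI)
      fix y z and a b :: real
      assume "y \<in> B" "z \<in> B" "0 \<le> a" "0 \<le> b" "a + b = 1"
      then show "a *\<^sub>R y + b *\<^sub>R z \<in> B"
        using B_add[OF B_scale[of y a] B_scale[of z b]] by (cases "a = 0"; cases "b = 0") auto
    qed
    show "?T1 \<inter> B = {}"
      using xi_le by (fastforce simp: B_def)
    have "(0, - 1) \<in> B"
      using zero_in_tangent_cone_infinity[of "epi f2"]
      by (auto simp: B_def zero_prod_def intro!: exI[of _ 0])
    then show "B \<noteq> {}" by blast
    fix a assume a: "a \<noteq> 0" "\<And>x. x \<in> ?T1 \<Longrightarrow> 0 \<le> inner a x" "\<And>x. x \<in> B \<Longrightarrow> inner a x \<le> 0"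
    show thesis
    proof (rule that[of "fst a" "snd a"])
      show "(fst a, snd a) \<noteq> 0" using a(1) by simp
      show "0 \<le> inner (fst a) v + snd a * r" if "(v, r) \<in> ?T1" for v r
        using a(2)[OF that] by (simp add: inner_prod_def)
      show "inner (fst a) v + snd a * b \<le> 0" if "(v, b) \<in> B" for v b
        using a(3)[OF that] by (simp add: inner_prod_def)
    qed
  qed (use convex_tangent_cone_infinity zero_in_tangent_cone_infinity tangent_cone_infinity_scaleR
      B_scale in auto)
  have "(0, 0) \<in> ?T1"
    using zero_in_tangent_cone_infinity[of "epi f1"] by (simp add: zero_prod_def)
  \<comment> \<open>The upward vertical direction is tangent and reveals the sign of
    \<open>beta\<close>.\<close>
  then have "(0, 1) \<in> ?T1"
    using descent_rate_if_tangent_cone_epi[of f1, OF f1, of 0 0 1]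
    by (simp add: tangent_cone_epi_if_descent_rate)
  with sep(2) have "0 \<le> beta" by fastforce
  \<comment> \<open>If \<open>beta\<close> were 0, \<open>eta\<close> would be nonnegative at
    \<open>v0\<close> because of \<open>?T1\<close>, yet nonpositive on a ball around
    \<open>v0\<close> because of \<open>B\<close>. Moving from \<open>v0\<close> along
    \<open>eta\<close> by the radius \<open>e\<close> contradicts this.\<close>
  moreover have "beta \<noteq> 0"
  proof
    assume "beta = 0"
    with sep(1) have eta: "eta \<noteq> 0" by (simp add: zero_prod_def)
    have "0 \<le> inner eta v0"
      using sep(2)[OF r0] \<open>beta = 0\<close> by simp
    obtain e where e: "0 < e" "cball v0 e \<subseteq> upper_subderivative_dom f2"
      using v0(2) unfolding mem_interior_cball by blast
    define c where "c = e / norm eta"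
    have "0 < c" using e(1) eta by (simp add: c_def)
    have "v0 + c *\<^sub>R eta \<in> upper_subderivative_dom f2"
      using e eta by (intro subsetD[OF e(2)]) (simp add: dist_norm c_def)
    then obtain r where "(v0 + c *\<^sub>R eta, r) \<in> ?T2"
      using tangent[of f2, OF f2] by blast
    then have "(v0 + c *\<^sub>R eta, inner (v0 + c *\<^sub>R eta) xi - r - 1) \<in> B"
      by (auto simp: B_def)
    from sep(3)[OF this] have "inner eta v0 + c * inner eta eta \<le> 0"
      using \<open>beta = 0\<close> by (simp add: inner_add_right)
    moreover have "0 < c * inner eta eta"
      using \<open>0 < c\<close> eta by simp
    ultimately show False
      using \<open>0 \<le> inner eta v0\<close> by simp
  qed
  ultimately have beta: "0 < beta" by simp
  \<comment> \<open>Normalised so that \<open>(eta, beta)\<close> is \<open>- beta\<close> times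
    \<open>(xi1, - 1)\<close>, which turns the separation on \<open>?T1\<close> into membership in
    the normal cone.\<close>
  define xi1 where "xi1 = - (1 / beta) *\<^sub>R eta"
  have xi1: "inner eta v = - beta * inner v xi1" for v
    using beta by (simp add: xi1_def inner_commute)
  have "xi1 \<in> subdifferential_infinity f1"
    unfolding mem_subdifferential_infinity_iff
  proof (intro allI impI)
    fix v r assume "(v, r) \<in> ?T1"
    from sep(2)[OF this] have "beta * inner v xi1 \<le> beta * r"
      by (simp add: xi1)
    then show "inner v xi1 \<le> r" using beta by simp
  qed
  moreover have "xi - xi1 \<in> subdifferential_infinity f2"
    unfolding mem_subdifferential_infinity_iff
  proof (intro allI impI, rule field_le_epsilon)
    \<comment> \<open>The amount \<open>d\<close> moves the point strictly below the bound defining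
      \<open>B\<close>; it is arbitrary and so disappears from the final estimate.\<close>
    fix v r and d :: real assume "(v, r) \<in> ?T2" "0 < d"
    then have "(v, inner v xi - r - d) \<in> B"
      by (auto simp: B_def)
    from sep(3)[OF this] have "beta * (inner v xi - r - d - inner v xi1) \<le> 0"
      by (simp add: xi1 algebra_simps)
    then show "inner v (xi - xi1) \<le> r + d"
      using beta by (simp add: mult_le_0_iff inner_diff_right)
  qed
  ultimately have "xi1 + (xi - xi1) \<in> subdifferential_infinity f1 + subdifferential_infinity f2"
    by (rule set_plus_intro)
  then show "xi \<in> subdifferential_infinity f1 + subdifferential_infinity f2"
    by simp
qed

end
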